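(* Let $F$ be a field. If $A\in F^{n\times n}$ is singular and $\lambda\in F$, then $C_F(A,\lambda)\neq\{0\}$.
   Context: For a field $F$, $A\in F^{n\times n}$ and $\lambda\in F$, $C_F(A,\lambda)=\{B\in F^{n\times n}\mid AB-\lambda BA=0\}$. *)

theory Defs
  imports Jordan_Normal_Form.Determinant
begin

definition lambda_commutant :: "nat \<Rightarrow> 'a::field mat \<Rightarrow> 'a \<Rightarrow> 'a mat set" where
  "lambda_commutant n A l =
     {B \<in> carrier_mat n n. A * B - l \<cdot>\<^sub>m (B * A) = 0\<^sub>m n n}"

end

theory Submission
  imports Defs
begin

text \<open>
  A singular matrix has a nonzero right null vector \<open>v\<close> and, since its transpose is singular
  too, a nonzero left null vector \<open>w\<close>. The rank-one matrix \<open>B = v w\<^sup>T\<close> is then a nonzero matrix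
  with \<open>A B = (A v) w\<^sup>T = 0\<close> and \<open>B A = v (w\<^sup>T A) = 0\<close>. As both products vanish separately,
  \<open>B\<close> satisfies \<open>A B = \<lambda> B A\<close> for every scalar \<open>\<lambda>\<close> at once.
\<close>

text \<open>
  Contrapositive of inversion by the adjugate: if the determinant is nonzero, dividing the
  adjugate by it gives a two-sided inverse.
\<close>

lemma det_eq_0_if_not_invertible_mat:
  fixes A :: "'a::field mat"
  assumes A: "A \<in> carrier_mat n n" and "\<not> invertible_mat A"
  shows "det A = 0"
proof (rule ccontr)
  assume d: "det A \<noteq> 0"
  let ?B = "inverse (det A) \<cdot>\<^sub>m adj_mat A"
  note adj = adj_mat[OF A]
  have "A * ?B = 1\<^sub>m n"
    using d unfolding mult_smult_distrib[OF A adj(1)] adj(2) by (intro eq_matI) auto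
  moreover have "?B * A = 1\<^sub>m n"
    using d unfolding mult_smult_assoc_mat[OF adj(1) A] adj(3) by (intro eq_matI) auto
  ultimately have "invertible_mat A"
    using A adj(1) unfolding invertible_mat_def inverts_mat_def by auto
  with assms(2) show False ..
qed

definition outer_prod_mat :: "'a::semiring_0 vec \<Rightarrow> 'a vec \<Rightarrow> 'a mat" where
  "outer_prod_mat v w = mat (dim_vec v) (dim_vec w) (\<lambda>(i, j). v $ i * w $ j)"

lemma outer_prod_mat_carrier:
  "v \<in> carrier_vec m \<Longrightarrow> w \<in> carrier_vec n \<Longrightarrow> outer_prod_mat v w \<in> carrier_mat m n"
  unfolding outer_prod_mat_def by auto

lemma mult_outer_prod_mat:
  assumes "A \<in> carrier_mat l m" "v \<in> carrier_vec m"
  shows "A * outer_prod_mat v w = outer_prod_mat (A *\<^sub>v v) w"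
  using assms unfolding outer_prod_mat_def
  by (intro eq_matI) (auto simp: scalar_prod_def sum_distrib_right mult.assoc)

lemma outer_prod_mat_mult:
  fixes A :: "'a::comm_semiring_0 mat"
  assumes "A \<in> carrier_mat n k" "w \<in> carrier_vec n"
  shows "outer_prod_mat v w * A = outer_prod_mat v (A\<^sup>T *\<^sub>v w)"
  using assms unfolding outer_prod_mat_def
  by (intro eq_matI) (auto simp: scalar_prod_def sum_distrib_left ac_simps)

lemma outer_prod_mat_zero_left:
  "w \<in> carrier_vec n \<Longrightarrow> outer_prod_mat (0\<^sub>v m) w = 0\<^sub>m m n"
  unfolding outer_prod_mat_def by (intro eq_matI) auto

lemma outer_prod_mat_zero_right:
  "v \<in> carrier_vec m \<Longrightarrow> outer_prod_mat v (0\<^sub>v n) = 0\<^sub>m m n"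
  unfolding outer_prod_mat_def by (intro eq_matI) auto

lemma outer_prod_mat_nonzero:
  fixes v w :: "'a::semiring_no_zero_divisors vec"
  assumes v: "v \<in> carrier_vec m" "v \<noteq> 0\<^sub>v m" and w: "w \<in> carrier_vec n" "w \<noteq> 0\<^sub>v n"
  shows "outer_prod_mat v w \<noteq> 0\<^sub>m m n"
proof
  have nonzero_entry: "\<exists>i<k. u $ i \<noteq> 0"
    if "u \<in> carrier_vec k" "u \<noteq> 0\<^sub>v k" for u :: "'a vec" and k
    using that eq_vecI[of u "0\<^sub>v k"] by auto
  assume zero: "outer_prod_mat v w = 0\<^sub>m m n"
  obtain i where i: "i < m" "v $ i \<noteq> 0" using nonzero_entry[OF v] by auto
  obtain j where j: "j < n" "w $ j \<noteq> 0" using nonzero_entry[OF w] by auto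
  have "v $ i * w $ j = outer_prod_mat v w $$ (i, j)"
    using v w i j unfolding outer_prod_mat_def by auto
  also have "\<dots> = 0" using zero i j by simp
  finally show False using i j by simp
qed

theorem corollary2p7:
  fixes A :: "'a::field mat" and l :: 'a and n :: nat
  assumes "A \<in> carrier_mat n n"
    and "\<not> invertible_mat A"
  shows "lambda_commutant n A l \<noteq> {0\<^sub>m n n}"
proof -
  note A = assms(1)
  have At: "A\<^sup>T \<in> carrier_mat n n" using A by simp
  have det: "det A = 0" "det A\<^sup>T = 0"
    using det_eq_0_if_not_invertible_mat[OF assms] det_transpose[OF A] by auto
  obtain v where v: "v \<in> carrier_vec n" "v \<noteq> 0\<^sub>v n" "A *\<^sub>v v = 0\<^sub>v n"
    using det(1) det_0_iff_vec_prod_zero_field[OF A] by auto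
  obtain w where w: "w \<in> carrier_vec n" "w \<noteq> 0\<^sub>v n" "A\<^sup>T *\<^sub>v w = 0\<^sub>v n"
    using det(2) det_0_iff_vec_prod_zero_field[OF At] by auto
  let ?B = "outer_prod_mat v w"
  have "A * ?B = 0\<^sub>m n n"
    using mult_outer_prod_mat[OF A v(1)] v(3) outer_prod_mat_zero_left[OF w(1)] by simp
  moreover have "?B * A = 0\<^sub>m n n"
    using outer_prod_mat_mult[OF A w(1)] w(3) outer_prod_mat_zero_right[OF v(1)] by simp
  ultimately have "?B \<in> lambda_commutant n A l"
    using outer_prod_mat_carrier[OF v(1) w(1)] unfolding lambda_commutant_def by auto
  then show ?thesis
    using outer_prod_mat_nonzero[OF v(1,2) w(1,2)] by auto
qed

end
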